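(* The following are equivalent. (a) Ulam's conjecture is true: any two graphs $G,H$ on more than $2$ vertices with $\mathcal{VD}(G)=\mathcal{VD}(H)$ are isomorphic. (b) Every disconnected graph on three or more vertices having at least one edge is $\mathcal{N}$-matrix reconstructible.
   Context: All graphs are finite and simple. The vertex deck $\mathcal{VD}(G)$ is the multiset of isomorphism types of the graphs $G-v$, $v\in VG$. For graphs $G,F$, $\binom{G}{F}$ denotes the number of induced subgraphs of $G$ isomorphic to $F$. A graph is nonempty if it has at least one edge. Let $\Lambda(G)=\{\Lambda_1,\dots,\Lambda_I\}$ be the set of distinct isomorphism types of nonempty induced subgraphs of $G$ (including $G$ itself if it is nonempty). The matrix $\mathcal{N}(G)=(N_{ij})$ is the $I\times I$ matrix with $N_{ij}=\binom{\Lambda_i}{\Lambda_j}$. It is regarded as unlabelled: the graphs $\Lambda_i$ indexing its rows and columns are not given, so $\mathcal{N}(G)=\mathcal{N}(H)$ means that the two matrices have the same size and agree after applying one and the same permutation to the rows and columns of one of them. A graph $G$ with at least one edge is $\mathcal{N}$-matrix reconstructible if every graph $H$ with at least one edge (connected or not) and $\mathcal{N}(H)=\mathcal{N}(G)$ is isomorphic to $G$. *)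

theory Defs
  imports
    "Graph_Theory.Pair_Digraph"
    "Graph_Theory.Digraph_Component"
    "Graph_Theory.Digraph_Isomorphism"
    "HOL-Library.Multiset"
begin

text \<open>
  A finite simple graph is a \<open>pair_graph\<close>: a finite, loop-free, symmetric set of pairs on a finite
  vertex set, an undirected edge being a pair of opposite arcs. Vertices are natural numbers; every
  finite graph has an isomorphic copy of this kind, so quantifying over these graphs is no
  restriction on statements that are invariant under isomorphism.
\<close>

type_synonym ngraph = "nat pair_pre_digraph"

abbreviation isomorphic :: "ngraph \<Rightarrow> ngraph \<Rightarrow> bool" where
  "isomorphic G H \<equiv> digraph_iso (with_proj G) (with_proj H)"

definition nonempty_graph :: "ngraph \<Rightarrow> bool" where
  "nonempty_graph G \<longleftrightarrow> parcs G \<noteq> {}"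

text \<open>
  The argument is a general digraph because the library's vertex deletion returns one.
\<close>
definition iso_type :: "(nat, nat \<times> nat) pre_digraph \<Rightarrow> ngraph set" where
  "iso_type G = {K. pair_graph K \<and> digraph_iso G (with_proj K)}"

definition vertex_deck :: "ngraph \<Rightarrow> ngraph set multiset" where
  "vertex_deck G =
     {# iso_type (pre_digraph.del_vert (with_proj G) v). v \<in># mset_set (pverts G) #}"

text \<open>
  \<open>induced_count G F\<close> is $\binom{G}{F}$.
\<close>
definition induced_count :: "ngraph \<Rightarrow> ngraph \<Rightarrow> nat" where
  "induced_count G F =
     card {K. induced_subgraph (with_proj K) (with_proj G) \<and> isomorphic K F}"

definition Lambda :: "ngraph \<Rightarrow> ngraph set set" where
  "Lambda G = {iso_type (with_proj K) | K.
     induced_subgraph (with_proj K) (with_proj G) \<and> nonempty_graph K}"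

text \<open>
  Since \<open>induced_count\<close> is invariant under isomorphism in both arguments, the choice of
  representatives does not matter. The matrix $\mathcal{N}(G)$ is indexed by \<open>Lambda G\<close> and has
  the entry \<open>N_entry S T\<close> in row \<open>S\<close> and column \<open>T\<close>.
\<close>
definition N_entry :: "ngraph set \<Rightarrow> ngraph set \<Rightarrow> nat" where
  "N_entry S T = induced_count (SOME F. F \<in> S) (SOME F. F \<in> T)"

text \<open>
  Equality, up to one and the same permutation of rows and columns, of a square matrix \<open>A\<close> indexed
  by the set \<open>I\<close> and a square matrix \<open>B\<close> indexed by the set \<open>J\<close>.
\<close>
definition unlabelled_matrix_eq ::
    "'i set \<Rightarrow> ('i \<Rightarrow> 'i \<Rightarrow> 'c) \<Rightarrow> 'j set \<Rightarrow> ('j \<Rightarrow> 'j \<Rightarrow> 'c) \<Rightarrow> bool" where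
  "unlabelled_matrix_eq I A J B \<longleftrightarrow>
     (\<exists>\<sigma>. bij_betw \<sigma> I J \<and> (\<forall>i\<in>I. \<forall>j\<in>I. A i j = B (\<sigma> i) (\<sigma> j)))"

definition same_N_matrix :: "ngraph \<Rightarrow> ngraph \<Rightarrow> bool" where
  "same_N_matrix G H \<longleftrightarrow> unlabelled_matrix_eq (Lambda G) N_entry (Lambda H) N_entry"

definition N_reconstructible :: "ngraph \<Rightarrow> bool" where
  "N_reconstructible G \<longleftrightarrow>
     (\<forall>H. pair_graph H \<and> nonempty_graph H \<and> same_N_matrix H G \<longrightarrow> isomorphic H G)"

end

theory Submission
  imports Defs
begin

text \<open>
  Assume Ulam's conjecture, and let \<open>\<sigma>\<close> be a bijection between the index sets of two equal
  matrices. By induction on the number of vertices, \<open>\<sigma>\<close> fixes every isomorphism type: a graph and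
  its image have the same proper nonempty induced subgraphs with the same multiplicities. Some card
  of a nonempty graph on at least three vertices is nonempty, so this information contains the
  number of vertices and hence the whole deck, the missing cards being edgeless.

  Conversely, let \<open>G\<close> and \<open>H\<close> have the same deck. By Kelly's lemma their matrices agree, the type
  of \<open>G\<close> corresponding to that of \<open>H\<close>. If one of them has an isolated vertex, it is disconnected
  and reconstructibility applies directly. Otherwise add an isolated vertex to both. The matrices of
  the enlarged graphs still agree, because an induced subgraph that uses the new vertex is counted
  by deleting an isolated vertex from it, and the new vertices can be cancelled afterwards.
\<close>

section \<open>Induced subgraphs and isomorphism types\<close>

text \<open>\<open>W\<close> itself becomes the vertex set, without intersection with
  \<open>pverts G\<close>. This makes \<open>induced G\<close> injective, so that copies of a graph
  can be counted as vertex sets.\<close>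

definition induced :: "ngraph \<Rightarrow> nat set \<Rightarrow> ngraph" where
  "induced G W = \<lparr>pverts = W, parcs = parcs G \<inter> W \<times> W\<rparr>"

abbreviation ty :: "ngraph \<Rightarrow> ngraph set" where
  "ty G \<equiv> iso_type (with_proj G)"

lemma induced_simps [simp]:
  "pverts (induced G W) = W" "parcs (induced G W) = parcs G \<inter> W \<times> W"
  by (simp_all add: induced_def)

section \<open>Pair graphs and their isomorphisms\<close>

lemma pair_graph_iff:
  "pair_graph G \<longleftrightarrow> finite (pverts G) \<and> parcs G \<subseteq> pverts G \<times> pverts G \<and> sym (parcs G) \<and> irrefl (parcs G)"
  (is "?L = ?R")
proof
  assume ?L
  then interpret pair_graph G .
  show ?R
    using pair_finite_verts arc_fst_in_verts arc_snd_in_verts pair_sym_arcs pair_no_loops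
    by (fastforce simp: symmetric_def irrefl_def)
next
  assume R: ?R
  then have "finite (parcs G)"
    by (meson finite_SigmaI finite_subset)
  then show ?L
    using R by unfold_locales (auto simp: symmetric_def irrefl_def)
qed

lemma
  assumes "pair_graph G"
  shows pair_graph_finite [simp]: "finite (pverts G)"
    and pair_graph_parcs: "parcs G \<subseteq> pverts G \<times> pverts G"
    and pair_graph_sym: "(u, v) \<in> parcs G \<Longrightarrow> (v, u) \<in> parcs G"
    and pair_graph_irrefl: "(u, u) \<notin> parcs G"
  using assms by (auto simp: pair_graph_iff sym_def irrefl_def)

lemma not_arc_outside:
  assumes "pair_graph G" "z \<notin> pverts G"
  shows "(u, z) \<notin> parcs G" "(z, u) \<notin> parcs G"
  using assms(2) pair_graph_parcs[OF assms(1)] by auto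

lemma pair_graph_induced [simp]:
  "pair_graph G \<Longrightarrow> W \<subseteq> pverts G \<Longrightarrow> pair_graph (induced G W)"
  by (auto simp: pair_graph_iff sym_def irrefl_def intro: finite_subset)

lemma induced_pverts [simp]: "pair_graph G \<Longrightarrow> induced G (pverts G) = G"
  using pair_graph_parcs[of G] by (cases G) (auto simp: induced_def)

lemma induced_induced [simp]: "W \<subseteq> U \<Longrightarrow> induced (induced G U) W = induced G W"
  by (auto simp: induced_def)

text \<open>Library isomorphisms carry a vertex map and an arc map. An arc here is the pair of its
  ends, so the vertex map \<open>f\<close> forces the arc map \<open>map_prod f f\<close>.\<close>

lemma isomorphic_iff:
  assumes "pair_graph G" "pair_graph H"
  shows "isomorphic G H \<longleftrightarrow> (\<exists>f. bij_betw f (pverts G) (pverts H) \<and>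
    (\<forall>u\<in>pverts G. \<forall>v\<in>pverts G. (u, v) \<in> parcs G \<longleftrightarrow> (f u, f v) \<in> parcs H))" (is "?L = ?R")
proof
  assume ?L
  then obtain h where h: "pre_digraph.digraph_isomorphism (with_proj G) h"
    and H: "with_proj H = app_iso h (with_proj G)"
    by (auto simp: digraph_iso_def)
  have V: "pverts H = iso_verts h ` pverts G" and A: "parcs H = iso_arcs h ` parcs G"
    and t: "iso_tail h = fst" and hd: "iso_head h = snd"
    using H by (auto simp: app_iso_def with_proj_def)
  have inj: "inj_on (iso_verts h) (pverts G)"
    and ends: "\<And>a. a \<in> parcs G \<Longrightarrow> iso_arcs h a = (iso_verts h (fst a), iso_verts h (snd a))"
    using h t hd by (auto simp: pre_digraph.digraph_isomorphism_def prod_eq_iff)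
  have "(u, v) \<in> parcs G \<longleftrightarrow> (iso_verts h u, iso_verts h v) \<in> parcs H"
    if uv: "u \<in> pverts G" "v \<in> pverts G" for u v
  proof
    show "(iso_verts h u, iso_verts h v) \<in> parcs H" if "(u, v) \<in> parcs G"
      unfolding A using ends[OF that] image_eqI[OF _ that, of _ "iso_arcs h"] by simp
    \<comment> \<open>An arc of \<open>H\<close> is the image of an arc \<open>a\<close> of
      \<open>G\<close>; injectivity on vertices identifies the ends of \<open>a\<close> with
      \<open>u\<close> and \<open>v\<close>.\<close>
    assume "(iso_verts h u, iso_verts h v) \<in> parcs H"
    then obtain a where a: "a \<in> parcs G" "iso_verts h u = iso_verts h (fst a)"
      "iso_verts h v = iso_verts h (snd a)"
      unfolding A using ends by auto
    moreover have "fst a \<in> pverts G" "snd a \<in> pverts G"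
      using a(1) pair_graph_parcs[OF assms(1)] by auto
    ultimately have "u = fst a" "v = snd a"
      using inj_onD[OF inj] uv by blast+
    then show "(u, v) \<in> parcs G"
      using a(1) by simp
  qed
  then show ?R
    using inj V unfolding bij_betw_def by blast
next
  assume ?R
  then obtain f where f: "bij_betw f (pverts G) (pverts H)"
    and e: "\<And>u v. u \<in> pverts G \<Longrightarrow> v \<in> pverts G \<Longrightarrow> (u, v) \<in> parcs G \<longleftrightarrow> (f u, f v) \<in> parcs H"
    by blast
  define h where "h = \<lparr>iso_verts = f, iso_arcs = map_prod f f, iso_head = snd, iso_tail = fst\<rparr>"
  interpret pair_graph G by fact
  have inj: "inj_on f (pverts G)" and V: "f ` pverts G = pverts H"
    using f by (auto simp: bij_betw_def)
  have "inj_on (map_prod f f) (parcs G)"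
    by (rule inj_on_subset[OF map_prod_inj_on[OF inj inj] pair_graph_parcs[OF assms(1)]])
  then have "digraph_isomorphism h"
    unfolding digraph_isomorphism_def using inj by (auto simp: h_def intro: wf_digraph_axioms)
  moreover have "parcs H = map_prod f f ` parcs G"
  proof (intro equalityI subsetI)
    fix a assume a: "a \<in> parcs H"
    then obtain u v where "u \<in> pverts G" "v \<in> pverts G" "a = (f u, f v)"
      using pair_graph_parcs[OF assms(2)] V by blast
    then show "a \<in> map_prod f f ` parcs G"
      using a e[of u v] image_eqI[of a "map_prod f f" "(u, v)" "parcs G"] by simp
  next
    fix a assume "a \<in> map_prod f f ` parcs G"
    then obtain u v where "(u, v) \<in> parcs G" "a = (f u, f v)"
      by auto
    then show "a \<in> parcs H"
      using e[of u v] pair_graph_parcs[OF assms(1)] by blast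
  qed
  then have "with_proj H = app_iso h (with_proj G)"
    using V by (simp add: app_iso_def with_proj_def h_def)
  ultimately show ?L
    unfolding digraph_iso_def by blast
qed

lemma isomorphic_refl [simp]: "pair_graph G \<Longrightarrow> isomorphic G G"
  by (auto simp: isomorphic_iff intro!: exI[of _ id])

lemma isomorphic_sym: "isomorphic G H \<Longrightarrow> pair_graph G \<Longrightarrow> isomorphic H G"
  by (auto intro!: digraph_iso_swap simp: wf_digraph_wp_iff pair_wf_digraph_def pair_graph_iff)

lemma isomorphic_card:
  "isomorphic G H \<Longrightarrow> pair_graph G \<Longrightarrow> pair_graph H \<Longrightarrow> card (pverts G) = card (pverts H)"
  by (auto simp: isomorphic_iff dest: bij_betw_same_card)

lemma isomorphic_nonempty:
  assumes "isomorphic G H" "pair_graph G" "pair_graph H" "nonempty_graph G"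
  shows "nonempty_graph H"
  using assms pair_graph_parcs[of G] unfolding nonempty_graph_def by (auto simp: isomorphic_iff)

lemma empty_isomorphic:
  assumes "pair_graph G" "pair_graph H" "\<not> nonempty_graph G" "\<not> nonempty_graph H"
    "card (pverts G) = card (pverts H)"
  shows "isomorphic G H"
  using assms finite_same_card_bij[of "pverts G" "pverts H"]
  by (auto simp: isomorphic_iff nonempty_graph_def)

lemma mem_ty: "K \<in> ty G \<longleftrightarrow> pair_graph K \<and> isomorphic G K"
  by (simp add: iso_type_def)

lemma ty_eq_iff:
  assumes "pair_graph G" "pair_graph H"
  shows "ty G = ty H \<longleftrightarrow> isomorphic G H"
proof
  assume "ty G = ty H"
  then show "isomorphic G H"
    using assms by (metis mem_ty isomorphic_refl)
next
  assume "isomorphic G H"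
  then show "ty G = ty H"
    using assms by (auto simp: set_eq_iff mem_ty intro: digraph_iso_trans isomorphic_sym)
qed

text \<open>Gives access to the representatives that \<open>N_entry\<close> selects by
  choice.\<close>

lemma some_mem_ty:
  assumes "pair_graph G"
  shows "pair_graph (SOME F. F \<in> ty G)" "isomorphic G (SOME F. F \<in> ty G)"
proof -
  have "(SOME F. F \<in> ty G) \<in> ty G"
    by (rule someI[of _ G]) (simp add: mem_ty assms)
  then show "pair_graph (SOME F. F \<in> ty G)" "isomorphic G (SOME F. F \<in> ty G)"
    by (auto simp: mem_ty)
qed

lemma isomorphic_induced:
  assumes f: "bij_betw f (pverts G) (pverts H)"
    and e: "\<forall>u\<in>pverts G. \<forall>v\<in>pverts G. (u, v) \<in> parcs G \<longleftrightarrow> (f u, f v) \<in> parcs H"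
    and "pair_graph G" "pair_graph H" "W \<subseteq> pverts G"
  shows "isomorphic (induced G W) (induced H (f ` W))"
proof -
  have W: "f ` W \<subseteq> pverts H"
    using f assms(5) by (auto simp: bij_betw_def)
  have bij: "bij_betw f (pverts (induced G W)) (pverts (induced H (f ` W)))"
    unfolding induced_simps using f assms(5) by (rule bij_betw_subset) simp
  have "(u, v) \<in> parcs (induced G W) \<longleftrightarrow> (f u, f v) \<in> parcs (induced H (f ` W))"
    if "u \<in> W" "v \<in> W" for u v
    using e[rule_format, OF subsetD subsetD, OF assms(5) that(1) assms(5) that(2)] that by simp
  then have arcs: "\<forall>u\<in>pverts (induced G W). \<forall>v\<in>pverts (induced G W).
      (u, v) \<in> parcs (induced G W) \<longleftrightarrow> (f u, f v) \<in> parcs (induced H (f ` W))"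
    unfolding induced_simps(1) by (intro ballI)
  show ?thesis
    unfolding isomorphic_iff[OF pair_graph_induced[OF assms(3,5)] pair_graph_induced[OF assms(4) W]]
    by (rule exI[of _ f]) (rule conjI[OF bij arcs])
qed

section \<open>Vertex deletion, induced subgraphs and their counts\<close>

lemma del_vert_eq_induced:
  "pair_graph G \<Longrightarrow> pre_digraph.del_vert (with_proj G) v = with_proj (induced G (pverts G - {v}))"
  by (auto simp: pre_digraph.del_vert_def with_proj_def dest: subsetD[OF pair_graph_parcs])

lemma vertex_deck_eq:
  "pair_graph G \<Longrightarrow> vertex_deck G = {# ty (induced G (pverts G - {v})). v \<in># mset_set (pverts G) #}"
  by (simp add: vertex_deck_def del_vert_eq_induced)

lemma induced_subgraph_iff:
  assumes "pair_graph G"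
  shows "induced_subgraph (with_proj K) (with_proj G) \<longleftrightarrow> (\<exists>W\<subseteq>pverts G. K = induced G W)" (is "?L = ?R")
proof
  assume L: ?L
  have "parcs K = parcs G \<inter> pverts K \<times> pverts K"
    using L by (simp add: induced_subgraph_def set_eq_iff mem_Times_iff)
  then have "K = induced G (pverts K)"
    by (intro pair_pre_digraph.equality) simp_all
  moreover have "pverts K \<subseteq> pverts G"
    using L by (auto simp: induced_subgraph_def subgraph_def)
  ultimately show ?R by blast
next
  assume ?R
  then obtain W where W: "W \<subseteq> pverts G" "K = induced G W" by blast
  then have "pair_graph K" using assms by simp
  then have "wf_digraph (with_proj K)" "wf_digraph (with_proj G)"
    using assms by (auto simp: wf_digraph_wp_iff pair_wf_digraph_def pair_graph_iff)
  then show ?L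
    using W by (auto simp: induced_subgraph_def subgraph_def)
qed

lemma induced_count_eq:
  assumes "pair_graph G"
  shows "induced_count G F = card {W. W \<subseteq> pverts G \<and> isomorphic (induced G W) F}"
proof -
  have "{K. induced_subgraph (with_proj K) (with_proj G) \<and> isomorphic K F}
      = induced G ` {W. W \<subseteq> pverts G \<and> isomorphic (induced G W) F}"
    using assms by (auto simp: induced_subgraph_iff)
  moreover have "inj_on (induced G) A" for A
    by (rule inj_onI) (metis induced_simps(1))
  ultimately show ?thesis
    by (simp add: induced_count_def card_image)
qed

lemma induced_count_cong:
  assumes "isomorphic G G'" "isomorphic F F'" "pair_graph G" "pair_graph G'" "pair_graph F" "pair_graph F'"
  shows "induced_count G F = induced_count G' F'"
proof -
  obtain f where f: "bij_betw f (pverts G) (pverts G')"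
    "\<forall>u\<in>pverts G. \<forall>v\<in>pverts G. (u, v) \<in> parcs G \<longleftrightarrow> (f u, f v) \<in> parcs G'"
    using assms by (auto simp: isomorphic_iff)
  have bij: "bij_betw (image f) (Pow (pverts G)) (Pow (pverts G'))"
    by (rule bij_betw_Pow[OF f(1)])
  have *: "isomorphic (induced G W) F \<longleftrightarrow> isomorphic (induced G' (f ` W)) F'" if W: "W \<subseteq> pverts G" for W
  proof -
    have W': "f ` W \<subseteq> pverts G'"
      using W f(1) by (auto simp: bij_betw_def)
    have "isomorphic (induced G W) (induced G' (f ` W))"
      by (rule isomorphic_induced) (use f W assms in auto)
    then show ?thesis
      using assms W W' by (meson isomorphic_sym digraph_iso_trans pair_graph_induced)
  qed
  have "bij_betw (image f) {W. W \<subseteq> pverts G \<and> isomorphic (induced G W) F}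
     {W. W \<subseteq> pverts G' \<and> isomorphic (induced G' W) F'}"
    unfolding bij_betw_def
  proof
    show "inj_on (image f) {W. W \<subseteq> pverts G \<and> isomorphic (induced G W) F}"
      using bij by (auto simp: bij_betw_def intro: inj_on_subset)
    show "image f ` {W. W \<subseteq> pverts G \<and> isomorphic (induced G W) F} =
      {W. W \<subseteq> pverts G' \<and> isomorphic (induced G' W) F'}" (is "?A = ?B")
    proof
      show "?A \<subseteq> ?B" using * bij_betwE[OF bij] by auto
      show "?B \<subseteq> ?A"
      proof
        fix W assume W: "W \<in> ?B"
        then obtain U where "U \<subseteq> pverts G" "W = f ` U"
          using bij by (auto simp: bij_betw_def) (metis (no_types) Pow_iff imageE)
        then show "W \<in> ?A" using W * by auto
      qed
    qed
  qed
  then show ?thesis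
    using assms by (auto simp: induced_count_eq dest: bij_betw_same_card)
qed

lemma N_entry_ty:
  assumes "pair_graph G" "pair_graph F"
  shows "N_entry (ty G) (ty F) = induced_count G F"
  unfolding N_entry_def using assms some_mem_ty[of G] some_mem_ty[of F]
  by (intro induced_count_cong) (auto intro: isomorphic_sym)

lemma induced_count_pos:
  assumes "pair_graph G"
  shows "0 < induced_count G F \<longleftrightarrow> (\<exists>W\<subseteq>pverts G. isomorphic (induced G W) F)"
proof -
  have "finite {W. W \<subseteq> pverts G \<and> isomorphic (induced G W) F}"
    using assms by (auto intro: finite_subset[of _ "Pow (pverts G)"])
  then show ?thesis
    using assms by (auto simp: induced_count_eq card_gt_0_iff)
qed

text \<open>A copy with as many vertices as \<open>G\<close> uses all of them. Thus the matrix is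
  triangular when its indices are ordered by number of vertices.\<close>

lemma induced_count_pos_card:
  assumes "0 < induced_count G F" "pair_graph G" "pair_graph F"
  shows "card (pverts F) \<le> card (pverts G)"
    and "card (pverts F) = card (pverts G) \<Longrightarrow> isomorphic G F"
proof -
  obtain W where W: "W \<subseteq> pverts G" "isomorphic (induced G W) F"
    using assms by (auto simp: induced_count_pos)
  have c: "card (pverts F) = card W"
    using isomorphic_card[OF W(2)] W assms by simp
  then show "card (pverts F) \<le> card (pverts G)"
    using W assms by (simp add: card_mono)
  show "isomorphic G F" if "card (pverts F) = card (pverts G)"
    using card_subset_eq[of "pverts G" W] W c that assms by simp
qed

lemma induced_count_eq_0:
  assumes "pair_graph G" "pair_graph F" "card (pverts G) \<le> card (pverts F)" "\<not> isomorphic G F"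
  shows "induced_count G F = 0"
  using induced_count_pos_card[of G F] assms by fastforce

lemma induced_count_induced_pos:
  "pair_graph G \<Longrightarrow> W \<subseteq> pverts G \<Longrightarrow> 0 < induced_count G (induced G W)"
  by (auto simp: induced_count_pos)

lemma induced_count_self:
  assumes "pair_graph G"
  shows "induced_count G G = 1"
proof -
  have "W = pverts G" if "W \<subseteq> pverts G" "isomorphic (induced G W) G" for W
    using isomorphic_card[OF that(2)] that assms by (simp add: card_subset_eq)
  then have "{W. W \<subseteq> pverts G \<and> isomorphic (induced G W) G} = {pverts G}"
    using assms by auto
  then show ?thesis
    using assms by (simp add: induced_count_eq)
qed

text \<open>A copy of \<open>F\<close> is found inside a copy of \<open>H\<close>. Hence whatever
  nonempty graph occurs in a member of \<open>Lambda G\<close> is again an index of the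
  matrix.\<close>

lemma induced_count_pos_trans:
  assumes "0 < induced_count G H" "0 < induced_count H F"
    "pair_graph G" "pair_graph H" "pair_graph F"
  shows "0 < induced_count G F"
proof -
  obtain W where W: "W \<subseteq> pverts G" "isomorphic (induced G W) H"
    using assms by (auto simp: induced_count_pos)
  have "induced_count (induced G W) F = induced_count H F"
    using W assms by (intro induced_count_cong) auto
  then obtain U where U: "U \<subseteq> W" "isomorphic (induced (induced G W) U) F"
    using assms W induced_count_pos[of "induced G W" F] by auto
  then show ?thesis
    unfolding induced_count_pos[OF assms(3)] using W(1) by (intro exI[of _ U]) simp
qed

text \<open>Positive counts replace actual subgraphs, which frees the representative
  \<open>F\<close> from having its vertices in \<open>G\<close>.\<close>

lemma Lambda_iff:
  assumes "pair_graph G"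
  shows "T \<in> Lambda G \<longleftrightarrow> (\<exists>F. pair_graph F \<and> nonempty_graph F \<and> 0 < induced_count G F \<and> T = ty F)"
    (is "?L = ?R")
proof
  assume ?L
  then show ?R
    using assms unfolding Lambda_def
    by (auto simp: induced_subgraph_iff intro!: induced_count_induced_pos pair_graph_induced)
next
  assume ?R
  then obtain F W where F: "pair_graph F" "nonempty_graph F" "T = ty F"
    and W: "W \<subseteq> pverts G" "isomorphic (induced G W) F"
    using assms by (auto simp: induced_count_pos)
  have "nonempty_graph (induced G W)"
    using F W assms by (meson isomorphic_nonempty isomorphic_sym pair_graph_induced)
  moreover have "T = ty (induced G W)"
    using F W assms by (simp add: ty_eq_iff isomorphic_sym)
  ultimately show ?L
    unfolding Lambda_def using W assms by (auto simp: induced_subgraph_iff)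
qed

lemma ty_in_Lambda_iff:
  assumes "pair_graph G" "pair_graph F"
  shows "ty F \<in> Lambda G \<longleftrightarrow> nonempty_graph F \<and> 0 < induced_count G F"
proof
  assume "ty F \<in> Lambda G"
  then obtain K where K: "pair_graph K" "nonempty_graph K" "0 < induced_count G K" "isomorphic K F"
    using assms by (auto simp: Lambda_iff) (metis ty_eq_iff)
  then show "nonempty_graph F \<and> 0 < induced_count G F"
    using assms isomorphic_nonempty[of K F] induced_count_cong[of G G K F] by simp
qed (use assms in \<open>auto simp: Lambda_iff\<close>)

lemma nonempty_card: "pair_graph G \<Longrightarrow> nonempty_graph G \<Longrightarrow> 2 \<le> card (pverts G)"
proof -
  assume G: "pair_graph G" "nonempty_graph G"
  then obtain u v where "(u, v) \<in> parcs G" "u \<noteq> v"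
    using pair_graph_irrefl[OF G(1)] by (auto simp: nonempty_graph_def)
  then have "{u, v} \<subseteq> pverts G" "card {u, v} = 2"
    using pair_graph_parcs[OF G(1)] by auto
  then show ?thesis
    using G by (metis card_mono pair_graph_finite)
qed

section \<open>From Ulam's conjecture to the matrix\<close>

text \<open>The base case not covered by Ulam's conjecture: both graphs are a single edge.\<close>

lemma isomorphic_of_card_2:
  assumes "pair_graph G" "pair_graph H" "nonempty_graph G" "nonempty_graph H"
    "card (pverts G) = 2" "card (pverts H) = 2"
  shows "isomorphic G H"
proof -
  have edge: "\<exists>u v. u \<noteq> v \<and> pverts K = {u, v} \<and> parcs K = {(u, v), (v, u)}"
    if K: "pair_graph K" "nonempty_graph K" "card (pverts K) = 2" for K
  proof -
    obtain u v where uv: "(u, v) \<in> parcs K"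
      using K(2) by (auto simp: nonempty_graph_def)
    then have "u \<noteq> v" and "{u, v} \<subseteq> pverts K"
      using pair_graph_irrefl[OF K(1)] pair_graph_parcs[OF K(1)] by auto
    then have V: "pverts K = {u, v}"
      using card_subset_eq[of "pverts K" "{u, v}"] K by simp
    moreover have "parcs K = {(u, v), (v, u)}"
      using pair_graph_parcs[OF K(1)] pair_graph_sym[OF K(1) uv] pair_graph_irrefl[OF K(1)] uv V
      by auto
    ultimately show ?thesis
      using \<open>u \<noteq> v\<close> by blast
  qed
  obtain u v where G: "u \<noteq> v" "pverts G = {u, v}" "parcs G = {(u, v), (v, u)}"
    using edge[of G] assms by blast
  obtain a b where H: "a \<noteq> b" "pverts H = {a, b}" "parcs H = {(a, b), (b, a)}"
    using edge[of H] assms by blast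
  have "bij_betw (\<lambda>x. if x = u then a else b) (pverts G) (pverts H)"
    using G H by (auto simp: bij_betw_def inj_on_def)
  then show ?thesis
    using G H assms
    by (auto simp: isomorphic_iff intro!: exI[of _ "\<lambda>x. if x = u then a else b"])
qed

text \<open>An edge occupies two vertices, and deleting a third one keeps it.\<close>

lemma nonempty_induced_Diff_singleton:
  assumes "pair_graph G" "nonempty_graph G" "3 \<le> card (pverts G)"
  shows "\<exists>v\<in>pverts G. nonempty_graph (induced G (pverts G - {v}))"
proof -
  obtain a b where ab: "(a, b) \<in> parcs G"
    using assms(2) by (auto simp: nonempty_graph_def)
  have "card {a, b} \<le> 2"
    by (simp add: card_insert_if)
  then have "\<not> pverts G \<subseteq> {a, b}"
    using assms(3) card_mono[of "{a, b}" "pverts G"] by fastforce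
  then obtain v where "v \<in> pverts G" "v \<noteq> a" "v \<noteq> b"
    by auto
  then show ?thesis
    using ab pair_graph_parcs[OF assms(1)] unfolding nonempty_graph_def
    by (intro bexI[of _ v]) auto
qed

section \<open>Decks and multiplicities of cards\<close>

lemma size_vertex_deck: "pair_graph G \<Longrightarrow> size (vertex_deck G) = card (pverts G)"
  by (simp add: vertex_deck_eq)

lemma set_vertex_deck:
  "pair_graph G \<Longrightarrow> set_mset (vertex_deck G) = (\<lambda>v. ty (induced G (pverts G - {v}))) ` pverts G"
  by (simp add: vertex_deck_eq)

text \<open>A copy of \<open>F\<close> omits exactly one vertex \<open>v\<close>, and then it is the
  card at \<open>v\<close>.\<close>

lemma count_vertex_deck:
  assumes "pair_graph G" "pair_graph F" "Suc (card (pverts F)) = card (pverts G)"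
  shows "count (vertex_deck G) (ty F) = induced_count G F"
proof -
  let ?A = "{v \<in> pverts G. isomorphic (induced G (pverts G - {v})) F}"
  let ?B = "{W. W \<subseteq> pverts G \<and> isomorphic (induced G W) F}"
  have "bij_betw (\<lambda>v. pverts G - {v}) ?A ?B"
    unfolding bij_betw_def
  proof
    show "inj_on (\<lambda>v. pverts G - {v}) ?A"
      by (rule inj_onI) blast
    have "\<exists>v\<in>pverts G. W = pverts G - {v}" if W: "W \<in> ?B" for W
    proof -
      have "card W = card (pverts F)"
        using W assms isomorphic_card[of "induced G W" F] by simp
      then have "card (pverts G - W) = 1"
        using W assms by (subst card_Diff_subset) (auto intro: finite_subset)
      then obtain v where "pverts G - W = {v}"
        by (auto simp: card_1_singleton_iff)
      then show ?thesis
        using W by blast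
    qed
    then have "?B \<subseteq> (\<lambda>v. pverts G - {v}) ` ?A"
      by (smt (verit) image_eqI mem_Collect_eq subsetI)
    then show "(\<lambda>v. pverts G - {v}) ` ?A = ?B"
      by auto
  qed
  then show ?thesis
    using assms
    by (simp add: vertex_deck_eq induced_count_eq count_image_mset_eq_card_vimage ty_eq_iff
        bij_betw_same_card cong: conj_cong)
qed

text \<open>The size fixes the one multiplicity that is left open.\<close>

lemma mset_eq_if_count_eq_except:
  assumes "size A = size B" "\<And>x. x \<noteq> e \<Longrightarrow> count A x = count B x"
  shows "A = B"
proof -
  have *: "filter_mset (\<lambda>x. x \<noteq> e) A = filter_mset (\<lambda>x. x \<noteq> e) B"
    using assms(2) by (auto intro: multiset_eqI)
  have "size M = size (filter_mset (\<lambda>x. x \<noteq> e) M) + count M e" for M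
    by (induction M) auto
  then have "count A e = count B e"
    using assms(1) * by (metis add_left_cancel)
  then show ?thesis
    using assms(2) by (metis multiset_eqI)
qed

text \<open>For a pair graph \<open>G\<close> and a graph with positive count, having fewer vertices
  amounts to not being isomorphic to \<open>G\<close>. The form by size suits induction on the
  number of vertices.\<close>

definition nonempty_below :: "ngraph \<Rightarrow> ngraph \<Rightarrow> bool" where
  "nonempty_below G F \<longleftrightarrow> pair_graph F \<and> nonempty_graph F \<and>
    card (pverts F) < card (pverts G) \<and> 0 < induced_count G F"

text \<open>
  All edgeless cards have the same type \<open>E\<close>, whose multiplicity follows from the size of the deck.
\<close>
lemma vertex_deck_eqI:
  assumes GH: "pair_graph G" "pair_graph H" "card (pverts G) = card (pverts H)"
    and below: "\<And>F. nonempty_below G F \<longleftrightarrow> nonempty_below H F"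
    and count: "\<And>F. nonempty_below G F \<Longrightarrow> induced_count G F = induced_count H F"
  shows "vertex_deck G = vertex_deck H"
proof -
  define E :: ngraph where "E = \<lparr>pverts = {..<card (pverts G) - 1}, parcs = {}\<rparr>"
  have E: "pair_graph E" "card (pverts E) = card (pverts G) - 1" "\<not> nonempty_graph E"
    by (auto simp: E_def pair_graph_iff sym_def irrefl_def nonempty_graph_def)
  \<comment> \<open>A type other than \<open>ty E\<close> either belongs to a nonempty graph of the
    size of a card, so that its multiplicity is a count, or occurs in neither deck.\<close>
  have "count (vertex_deck G) T = count (vertex_deck H) T" if T: "T \<noteq> ty E" for T
  proof (cases "\<exists>F. pair_graph F \<and> nonempty_graph F \<and> Suc (card (pverts F)) = card (pverts G) \<and> T = ty F")
    case True
    then obtain F where F: "pair_graph F" "nonempty_graph F" "Suc (card (pverts F)) = card (pverts G)" "T = ty F"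
      by blast
    have "induced_count G F = induced_count H F"
    proof (cases "nonempty_below G F")
      case False
      \<comment> \<open>\<open>F\<close> satisfies all other conditions of
        \<open>nonempty_below\<close>, so both counts are 0.\<close>
      then have "\<not> nonempty_below H F"
        using below by simp
      with False show ?thesis
        using F GH by (auto simp: nonempty_below_def)
    qed (rule count)
    then show ?thesis
      using F GH by (simp add: count_vertex_deck)
  next
    case False
    have "T \<notin># vertex_deck K" if K: "pair_graph K" "card (pverts K) = card (pverts G)" for K
    proof
      assume "T \<in># vertex_deck K"
      then obtain v where v: "v \<in> pverts K" "T = ty (induced K (pverts K - {v}))"
        using K by (auto simp: set_vertex_deck)
      let ?F = "induced K (pverts K - {v})"
      have F: "pair_graph ?F" "Suc (card (pverts ?F)) = card (pverts G)"
        using K v card_gt_0_iff[of "pverts K"] by auto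
      then have "\<not> nonempty_graph ?F"
        using False v by blast
      then have "isomorphic ?F E"
        using E F by (intro empty_isomorphic) auto
      then show False
        using T v F E by (simp add: ty_eq_iff)
    qed
    then show ?thesis
      using GH by (metis count_inI)
  qed
  then show ?thesis
    using GH by (intro mset_eq_if_count_eq_except[of _ _ "ty E"]) (simp_all add: size_vertex_deck)
qed

section \<open>Recovering types from their proper subgraphs under Ulam's conjecture\<close>

definition ulam_conjecture :: bool where
  "ulam_conjecture \<longleftrightarrow> (\<forall>G H :: ngraph. pair_graph G \<and> pair_graph H \<and>
     card (pverts G) > 2 \<and> card (pverts H) > 2 \<and> vertex_deck G = vertex_deck H \<longrightarrow> isomorphic G H)"

text \<open>The common proper subgraphs first yield equal numbers of vertices, then equal decks, to
  which the conjecture applies.\<close>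

lemma isomorphic_if_nonempty_below_eq:
  assumes ulam_conjecture
    and GH: "pair_graph G" "pair_graph H" "nonempty_graph G" "nonempty_graph H"
    and below: "\<And>F. nonempty_below G F \<longleftrightarrow> nonempty_below H F"
    and count: "\<And>F. nonempty_below G F \<Longrightarrow> induced_count G F = induced_count H F"
  shows "isomorphic G H"
proof -
  \<comment> \<open>Used in both directions. A nonempty card of \<open>K\<close> lies properly below
    \<open>L\<close>, so \<open>L\<close> has at least as many vertices as \<open>K\<close>; if
    \<open>K\<close> has at most two vertices, any edge of \<open>L\<close> suffices.\<close>
  have le: "card (pverts K) \<le> card (pverts L)"
    if KL: "pair_graph K" "nonempty_graph K" "pair_graph L" "nonempty_graph L"
      and imp: "\<And>F. nonempty_below K F \<Longrightarrow> nonempty_below L F" for K L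
  proof (cases "3 \<le> card (pverts K)")
    case True
    then obtain v where v: "v \<in> pverts K" "nonempty_graph (induced K (pverts K - {v}))"
      using nonempty_induced_Diff_singleton KL by blast
    have "nonempty_below K (induced K (pverts K - {v}))"
      using v KL True card_gt_0_iff[of "pverts K"]
      by (simp add: nonempty_below_def induced_count_induced_pos)
    then have "card (pverts K - {v}) < card (pverts L)"
      using imp by (fastforce simp: nonempty_below_def)
    then show ?thesis
      using v KL by simp
  next
    case False
    then show ?thesis
      using nonempty_card[of L] KL by simp
  qed
  then have c: "card (pverts G) = card (pverts H)"
    using GH below by (meson le_antisym)
  show ?thesis
  proof (cases "card (pverts G) = 2")
    case True
    then show ?thesis
      using isomorphic_of_card_2 GH c by simp
  next
    case False
    then have "2 < card (pverts G)"
      using nonempty_card[of G] GH by simp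
    then show ?thesis
      using vertex_deck_eqI[OF GH(1,2) c below count] \<open>ulam_conjecture\<close> GH c unfolding ulam_conjecture_def by auto
  qed
qed

text \<open>Once \<open>\<sigma>\<close> fixes every type, the type of each graph is an index for
  the other. Each then occurs in the other, so they have equally many vertices and are
  isomorphic.\<close>

lemma ulam_imp_N_matrix_determines:
  assumes ulam_conjecture
    and GH: "pair_graph G" "pair_graph H" "nonempty_graph G" "nonempty_graph H"
    and same: "same_N_matrix H G"
  shows "isomorphic H G"
proof -
  obtain \<sigma> where \<sigma>: "bij_betw \<sigma> (Lambda H) (Lambda G)"
    and N: "\<And>S T. S \<in> Lambda H \<Longrightarrow> T \<in> Lambda H \<Longrightarrow> N_entry S T = N_entry (\<sigma> S) (\<sigma> T)"
    using same by (auto simp: same_N_matrix_def unlabelled_matrix_eq_def)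
  have inj: "\<And>S T. S \<in> Lambda H \<Longrightarrow> T \<in> Lambda H \<Longrightarrow> \<sigma> S = \<sigma> T \<Longrightarrow> S = T"
    using \<sigma> by (auto simp: bij_betw_def inj_on_def)
  have surj: "\<exists>M. pair_graph M \<and> ty M \<in> Lambda H \<and> \<sigma> (ty M) = T" if T: "T \<in> Lambda G" for T
  proof -
    obtain S where S: "T = \<sigma> S" "S \<in> Lambda H"
      using T unfolding bij_betw_imp_surj_on[OF \<sigma>, symmetric] by (rule imageE)
    then obtain M where "pair_graph M" "S = ty M"
      unfolding Lambda_iff[OF GH(2)] by (elim exE conjE)
    then show ?thesis
      using S by metis
  qed
  \<comment> \<open>The size of a representative \<open>L\<close> of the image is unknown at first.
    It follows from comparing the proper subgraphs of \<open>K\<close> and \<open>L\<close>.\<close>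
  have fixed: "\<sigma> (ty K) = ty K" if "pair_graph K" "ty K \<in> Lambda H" for K
    using that
  proof (induction "card (pverts K)" arbitrary: K rule: less_induct)
    case less
    note K = less.prems
    have KH: "nonempty_graph K" "0 < induced_count H K"
      using K GH by (auto simp: ty_in_Lambda_iff)
    obtain L where L: "pair_graph L" "nonempty_graph L" "0 < induced_count G L" "\<sigma> (ty K) = ty L"
      using bij_betwE[OF \<sigma>, THEN bspec, OF K(2)] unfolding Lambda_iff[OF GH(1)] by blast
    \<comment> \<open>The column of \<open>F\<close> is fixed by induction, so the rows of
      \<open>K\<close> and \<open>L\<close> agree there.\<close>
    have 1: "nonempty_below L F \<and> induced_count K F = induced_count L F" if "nonempty_below K F" for F
    proof -
      have F: "pair_graph F" "nonempty_graph F" "card (pverts F) < card (pverts K)" "0 < induced_count K F"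
        using that by (auto simp: nonempty_below_def)
      have FH: "ty F \<in> Lambda H"
        using induced_count_pos_trans[of H K F] F K KH GH by (auto simp: ty_in_Lambda_iff)
      have "\<sigma> (ty F) = ty F"
        using less.hyps F FH by blast
      then have c: "induced_count K F = induced_count L F"
        using N[OF K(2) FH] L F K by (simp add: N_entry_ty)
      \<comment> \<open>Otherwise \<open>\<sigma>\<close> would send both \<open>ty K\<close> and
        \<open>ty F\<close> to \<open>ty L\<close>, against injectivity. So the copy of
        \<open>F\<close> in \<open>L\<close> is proper.\<close>
      have "\<not> isomorphic L F"
        using inj[OF K(2) FH] L F K \<open>\<sigma> (ty F) = ty F\<close> isomorphic_card[of K F] by (auto simp: ty_eq_iff)
      then have "card (pverts F) < card (pverts L)"
        using induced_count_pos_card[of L F] c F L by fastforce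
      then show ?thesis
        using c F by (auto simp: nonempty_below_def)
    qed
    have 2: "nonempty_below K F" if "nonempty_below L F" for F
    proof -
      have F: "pair_graph F" "nonempty_graph F" "card (pverts F) < card (pverts L)" "0 < induced_count L F"
        using that by (auto simp: nonempty_below_def)
      have "ty F \<in> Lambda G"
        using induced_count_pos_trans[of G L F] F L GH by (auto simp: ty_in_Lambda_iff)
      \<comment> \<open>The induction hypothesis cannot be applied to \<open>F\<close>, whose size
        is only compared with that of \<open>L\<close>. It is applied to a preimage \<open>M\<close>
        after \<open>M\<close> is shown to be smaller than \<open>K\<close>.\<close>
      then obtain M where M: "pair_graph M" "ty M \<in> Lambda H" "\<sigma> (ty M) = ty F"
        using surj by metis
      have pos: "0 < induced_count K M"
        using N[OF K(2) M(2)] L F K M by (simp add: N_entry_ty)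
      have "\<not> isomorphic K M"
      proof
      assume "isomorphic K M"
      then have "ty F = ty L"
        using L M K by (simp flip: ty_eq_iff)
      then show False
        using F L isomorphic_card[of F L] by (simp add: ty_eq_iff)
    qed
      then have "card (pverts M) < card (pverts K)"
        using induced_count_pos_card[of K M] pos M K by fastforce
      moreover from this have "isomorphic F M"
        using less.hyps[of M] M F by (simp add: ty_eq_iff)
      ultimately show ?thesis
        using F M K pos isomorphic_card[of F M] induced_count_cong[of K K F M]
        by (simp add: nonempty_below_def)
    qed
    have "isomorphic K L"
      using 1 2 by (intro isomorphic_if_nonempty_below_eq[OF \<open>ulam_conjecture\<close> K(1) L(1) KH(1) L(2)]) blast+
    then show ?case
      using L K by (simp add: ty_eq_iff isomorphic_sym)
  qed
  have "ty H \<in> Lambda H"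
    using GH by (simp add: ty_in_Lambda_iff induced_count_self)
  then have "ty H \<in> Lambda G"
    using fixed[of H] GH bij_betwE[OF \<sigma>] by metis
  then have 1: "0 < induced_count G H"
    using GH by (simp add: ty_in_Lambda_iff)
  have "ty G \<in> Lambda G"
    using GH by (simp add: ty_in_Lambda_iff induced_count_self)
  then obtain M where M: "pair_graph M" "ty M \<in> Lambda H" "\<sigma> (ty M) = ty G"
    using surj by metis
  then have "ty G \<in> Lambda H"
    using fixed[of M] by simp
  then have "0 < induced_count H G"
    using GH by (simp add: ty_in_Lambda_iff)
  then show ?thesis
    using 1 induced_count_pos_card GH by (metis le_antisym)
qed

section \<open>Kelly's lemma and isolated vertices\<close>

text \<open>Double counting of pairs of a copy of \<open>F\<close> and a vertex outside it: a copy
  survives in exactly the cards at the vertices that it avoids.\<close>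

lemma sum_induced_count_vertex_deleted:
  assumes "pair_graph G" "pair_graph F"
  shows "(\<Sum>v\<in>pverts G. induced_count (induced G (pverts G - {v})) F) =
    (card (pverts G) - card (pverts F)) * induced_count G F"
proof -
  let ?B = "{W. W \<subseteq> pverts G \<and> isomorphic (induced G W) F}"
  have fin: "finite ?B"
    by (rule finite_subset[of _ "Pow (pverts G)"]) (use assms in auto)
  have "induced_count (induced G (pverts G - {v})) F = card {W \<in> ?B. v \<notin> W}" if "v \<in> pverts G" for v
  proof -
    have "{W. W \<subseteq> pverts G - {v} \<and> isomorphic (induced (induced G (pverts G - {v})) W) F} = {W \<in> ?B. v \<notin> W}"
      by (auto simp: subset_Diff_insert)
    then show ?thesis
      using assms by (simp add: induced_count_eq)
  qed
  then have "(\<Sum>v\<in>pverts G. induced_count (induced G (pverts G - {v})) F) =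
      (\<Sum>v\<in>pverts G. card {W \<in> ?B. v \<notin> W})"
    by simp
  also have "\<dots> = (card (pverts G) - card (pverts F)) * card ?B"
  proof (rule sum_multicount)
    show "\<forall>W\<in>?B. card {v \<in> pverts G. v \<notin> W} = card (pverts G) - card (pverts F)"
    proof
      fix W assume W: "W \<in> ?B"
      then have "card W = card (pverts F)"
        using isomorphic_card[of "induced G W" F] assms by simp
      moreover have "{v \<in> pverts G. v \<notin> W} = pverts G - W"
        by auto
      moreover have "finite W"
        using W assms by (auto intro: finite_subset)
      ultimately show "card {v \<in> pverts G. v \<notin> W} = card (pverts G) - card (pverts F)"
        using W by (simp add: card_Diff_subset)
    qed
  qed (use fin assms in auto)
  finally show ?thesis
    using assms by (simp add: induced_count_eq)
qed

text \<open>The sum over the cards depends only on the deck, and the factor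
  \<open>card (pverts G) - card (pverts F)\<close> is positive and cancels.\<close>

lemma kelly:
  assumes "pair_graph G" "pair_graph H" "pair_graph F" "vertex_deck G = vertex_deck H"
    "card (pverts F) < card (pverts G)"
  shows "induced_count G F = induced_count H F"
proof -
  \<comment> \<open>Writing the summands with \<open>N_entry\<close> turns the sum into a function
    of the types in the deck.\<close>
  have *: "(\<Sum>T\<in>#vertex_deck K. N_entry T (ty F)) =
      (card (pverts K) - card (pverts F)) * induced_count K F" if K: "pair_graph K" for K
  proof -
    have "(\<Sum>T\<in>#vertex_deck K. N_entry T (ty F)) =
        (\<Sum>v\<in>pverts K. N_entry (ty (induced K (pverts K - {v}))) (ty F))"
      using K by (simp add: vertex_deck_eq image_mset.compositionality comp_def sum_unfold_sum_mset)
    also have "\<dots> = (\<Sum>v\<in>pverts K. induced_count (induced K (pverts K - {v})) F)"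
      using K assms(3) by (simp add: N_entry_ty)
    finally show ?thesis
      using sum_induced_count_vertex_deleted[OF K assms(3)] by simp
  qed
  have "card (pverts G) = card (pverts H)"
    using assms size_vertex_deck by metis
  then show ?thesis
    using *[OF assms(1)] *[OF assms(2)] assms(4,5) by simp
qed

text \<open>Some card of \<open>G\<close> keeps an edge and reappears as a card of \<open>H\<close>.
  For two vertices this fails: an edge and its complement have the same deck.\<close>

lemma nonempty_of_deck_eq:
  assumes "pair_graph G" "pair_graph H" "vertex_deck G = vertex_deck H" "3 \<le> card (pverts G)"
    "nonempty_graph G"
  shows "nonempty_graph H"
proof -
  obtain v where v: "v \<in> pverts G" "nonempty_graph (induced G (pverts G - {v}))"
    using nonempty_induced_Diff_singleton assms by blast
  then have "ty (induced G (pverts G - {v})) \<in># vertex_deck H"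
    using assms set_vertex_deck[of G] by auto
  then obtain w where "w \<in> pverts H"
    "ty (induced G (pverts G - {v})) = ty (induced H (pverts H - {w}))"
    using assms set_vertex_deck[of H] by auto
  then have "nonempty_graph (induced H (pverts H - {w}))"
    using v isomorphic_nonempty[of "induced G (pverts G - {v})" "induced H (pverts H - {w})"] assms
    by (simp add: ty_eq_iff)
  then show ?thesis
    by (auto simp: nonempty_graph_def)
qed

section \<open>Isolated vertices\<close>

definition isolated :: "ngraph \<Rightarrow> nat \<Rightarrow> bool" where
  "isolated G v \<longleftrightarrow> v \<in> pverts G \<and> (\<forall>u. (u, v) \<notin> parcs G \<and> (v, u) \<notin> parcs G)"

text \<open>Library connectedness is strong connectedness of the symmetric closure. A walk there
  from \<open>v\<close> to another vertex would start with an arc at \<open>v\<close>.\<close>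

lemma isolated_not_connected:
  assumes "isolated G v" "2 \<le> card (pverts G)"
  shows "\<not> Digraph_Component.connected (with_proj G)"
proof
  assume conn: "Digraph_Component.connected (with_proj G)"
  let ?S = "mk_symmetric (with_proj G)"
  have S: "pverts ?S = pverts G" "parcs ?S = (\<Union>e\<in>parcs G. {(fst e, snd e), (snd e, fst e)})"
    by (simp_all add: mk_symmetric_def)
  have "\<not> pverts G \<subseteq> {v}"
    using assms(2) card_mono[of "{v}" "pverts G"] by fastforce
  then obtain u where u: "u \<in> pverts G" "u \<noteq> v"
    by auto
  have "reachable (with_proj ?S) v u"
    using conn u(1) assms(1) S unfolding connected_def strongly_connected_def isolated_def by simp
  then have "(v, u) \<in> (parcs ?S)\<^sup>*"
    by (auto dest: reachable_rtranclI)
  then show False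
  proof (cases rule: converse_rtranclE)
    case (step y)
    then show False
      using assms(1) unfolding S isolated_def by auto
  qed (use u in simp)
qed

lemma isolated_isomorphic:
  assumes f: "bij_betw f (pverts G) (pverts H)"
    and e: "\<forall>u\<in>pverts G. \<forall>v\<in>pverts G. (u, v) \<in> parcs G \<longleftrightarrow> (f u, f v) \<in> parcs H"
    and G: "pair_graph G" and u: "u \<in> pverts G" "isolated H (f u)"
  shows "isolated G u"
proof -
  have "(w, u) \<notin> parcs G \<and> (u, w) \<notin> parcs G" for w
    using e[rule_format, of w u] e[rule_format, of u w] u pair_graph_parcs[OF G]
    unfolding isolated_def by blast
  then show ?thesis
    using u by (simp add: isolated_def)
qed

lemma ex_isolated_isomorphic:
  assumes "isomorphic G H" "pair_graph G" "pair_graph H" "isolated H v"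
  shows "\<exists>u. isolated G u"
proof -
  obtain f where f: "bij_betw f (pverts G) (pverts H)"
    "\<forall>u\<in>pverts G. \<forall>v\<in>pverts G. (u, v) \<in> parcs G \<longleftrightarrow> (f u, f v) \<in> parcs H"
    using assms(1) unfolding isomorphic_iff[OF assms(2,3)] by blast
  have "v \<in> f ` pverts G"
    using bij_betw_imp_surj_on[OF f(1)] assms(4) by (simp add: isolated_def)
  then obtain u where "u \<in> pverts G" "v = f u"
    by blast
  then show ?thesis
    using isolated_isomorphic[OF f assms(2)] assms(4) by blast
qed

text \<open>Let \<open>u\<close> take the place of \<open>v\<close> and fix all other vertices; no
  arc is touched.\<close>

lemma isomorphic_delete_isolated:
  assumes "pair_graph G" "isolated G u" "isolated G v"
  shows "isomorphic (induced G (pverts G - {u})) (induced G (pverts G - {v}))"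
proof -
  let ?f = "\<lambda>x. if x = v then u else x"
  have "bij_betw ?f (pverts G - {u}) (pverts G - {v})"
    using assms(2,3) by (auto simp: bij_betw_def inj_on_def isolated_def image_iff)
  moreover have "\<forall>x\<in>pverts G - {u}. \<forall>y\<in>pverts G - {u}.
    (x, y) \<in> parcs (induced G (pverts G - {u})) \<longleftrightarrow> (?f x, ?f y) \<in> parcs (induced G (pverts G - {v}))"
    using assms(2,3) by (auto simp: isolated_def)
  ultimately show ?thesis
    using isomorphic_iff[of "induced G (pverts G - {u})" "induced G (pverts G - {v})"] assms(1)
    by (auto simp del: induced_simps(2))
qed

section \<open>Adding and cancelling an isolated vertex\<close>

definition add_isolated :: "ngraph \<Rightarrow> nat \<Rightarrow> ngraph" where
  "add_isolated G z = \<lparr>pverts = insert z (pverts G), parcs = parcs G\<rparr>"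

lemma add_isolated_simps [simp]:
  "pverts (add_isolated G z) = insert z (pverts G)" "parcs (add_isolated G z) = parcs G"
  by (simp_all add: add_isolated_def)

lemma pair_graph_add_isolated [simp]: "pair_graph G \<Longrightarrow> pair_graph (add_isolated G z)"
  by (auto simp: pair_graph_iff)

lemma nonempty_add_isolated [simp]: "nonempty_graph (add_isolated G z) \<longleftrightarrow> nonempty_graph G"
  by (simp add: nonempty_graph_def)

lemma isolated_add_isolated: "pair_graph G \<Longrightarrow> z \<notin> pverts G \<Longrightarrow> isolated (add_isolated G z) z"
  using pair_graph_parcs[of G] by (auto simp: isolated_def)

lemma induced_add_isolated:
  assumes "z \<notin> pverts G" "W \<subseteq> pverts G" "pair_graph G"
  shows "induced (add_isolated G z) W = induced G W"
    and "induced (add_isolated G z) (insert z W) = add_isolated (induced G W) z"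
  using assms pair_graph_parcs[OF assms(3)] by (auto simp: induced_def add_isolated_def)

lemma isolated_eq_add_isolated:
  assumes "pair_graph G" "isolated G v"
  shows "G = add_isolated (induced G (pverts G - {v})) v"
  using assms(2) pair_graph_parcs[OF assms(1)]
  by (intro pair_pre_digraph.equality) (auto simp: isolated_def)

text \<open>An isomorphism may send to \<open>w\<close> a vertex \<open>u\<close> other than
  \<open>z\<close>. But \<open>u\<close> is isolated as well, and deleting \<open>u\<close> or
  \<open>z\<close> gives isomorphic graphs.\<close>

lemma isomorphic_add_isolated_iff:
  assumes G: "pair_graph G" "z \<notin> pverts G" and H: "pair_graph H" "w \<notin> pverts H"
  shows "isomorphic (add_isolated G z) (add_isolated H w) \<longleftrightarrow> isomorphic G H" (is "?L \<longleftrightarrow> ?R")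
proof
  let ?G = "add_isolated G z" and ?H = "add_isolated H w"
  have pg: "pair_graph ?G" "pair_graph ?H"
    using G H by simp_all
  assume ?L
  then obtain f where f: "bij_betw f (pverts ?G) (pverts ?H)"
    "\<forall>u\<in>pverts ?G. \<forall>v\<in>pverts ?G. (u, v) \<in> parcs ?G \<longleftrightarrow> (f u, f v) \<in> parcs ?H"
    unfolding isomorphic_iff[OF pg] by blast
  have surj: "f ` pverts ?G = pverts ?H" and inj: "inj_on f (pverts ?G)"
    using f(1) by (simp_all only: bij_betw_def)
  have "w \<in> f ` pverts ?G"
    unfolding surj by simp
  then obtain u where u: "u \<in> pverts ?G" "w = f u"
    by blast
  have iso_u: "isolated ?G u"
    using isolated_isomorphic[OF f pg(1) u(1)] isolated_add_isolated[OF H] u(2) by simp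
  have "f ` (pverts ?G - {u}) = f ` pverts ?G - {w}"
    using inj u by (simp add: inj_on_image_set_diff[of f "pverts ?G"])
  also have "\<dots> = pverts H"
    unfolding surj using H by simp
  finally have "isomorphic (induced ?G (pverts ?G - {u})) (induced ?H (pverts H))"
    using isomorphic_induced[OF f pg, of "pverts ?G - {u}"] by simp
  then have 1: "isomorphic (induced ?G (pverts ?G - {u})) H"
    using induced_add_isolated(1)[of w H "pverts H"] H by simp
  have "pverts ?G - {z} = pverts G"
    using G by simp
  then have "isomorphic (induced ?G (pverts G)) (induced ?G (pverts ?G - {u}))"
    using isomorphic_delete_isolated[OF pg(1) isolated_add_isolated[OF G] iso_u] by simp
  then have 2: "isomorphic G (induced ?G (pverts ?G - {u}))"
    using induced_add_isolated(1)[of z G "pverts G"] G by simp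
  show ?R
    by (rule digraph_iso_trans[OF 2 1])
next
  assume ?R
  then obtain f where f: "bij_betw f (pverts G) (pverts H)"
    and e: "\<forall>u\<in>pverts G. \<forall>v\<in>pverts G. (u, v) \<in> parcs G \<longleftrightarrow> (f u, f v) \<in> parcs H"
    unfolding isomorphic_iff[OF G(1) H(1)] by blast
  \<comment> \<open>Conversely, \<open>f\<close> is extended by sending the new vertex to the new
    vertex; neither is on an arc.\<close>
  let ?f = "\<lambda>x. if x = z then w else f x"
  have eq: "?f x = f x" if "x \<in> pverts G" for x
    using that G(2) by auto
  have "bij_betw ?f (pverts G) (pverts H)"
    using f bij_betw_cong[of "pverts G" ?f f] eq by blast
  then have bij: "bij_betw ?f (pverts (add_isolated G z)) (pverts (add_isolated H w))"
    using G(2) H(2) notIn_Un_bij_betw[of z "pverts G" ?f "pverts H"] by simp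
  have *: "(x, y) \<in> parcs G \<longleftrightarrow> (?f x, ?f y) \<in> parcs H" if "x \<in> insert z (pverts G)" "y \<in> insert z (pverts G)" for x y
  proof (cases "x = z \<or> y = z")
    case True
    then show ?thesis
      using not_arc_outside[OF G] not_arc_outside[OF H] by auto
  next
    case False
    then show ?thesis
      using e[rule_format, of x y] that by simp
  qed
  show ?L
    unfolding isomorphic_iff[OF pair_graph_add_isolated[OF G(1)] pair_graph_add_isolated[OF H(1)]]
    by (rule exI[of _ ?f], rule conjI[OF bij]) (use * in \<open>unfold add_isolated_simps, blast\<close>)
qed

text \<open>Copies are split by whether they use \<open>z\<close>; those that do are recorded by
  their other vertices \<open>W\<close>.\<close>

lemma induced_count_add_isolated:
  assumes G: "pair_graph G" "z \<notin> pverts G"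
  shows "induced_count (add_isolated G z) F = induced_count G F +
    card {W. W \<subseteq> pverts G \<and> isomorphic (add_isolated (induced G W) z) F}"
proof -
  let ?A = "{W. W \<subseteq> pverts G \<and> isomorphic (induced G W) F}"
  let ?B = "{W. W \<subseteq> pverts G \<and> isomorphic (add_isolated (induced G W) z) F}"
  let ?X = "{W. W \<subseteq> pverts (add_isolated G z) \<and> isomorphic (induced (add_isolated G z) W) F}"
  have "?X = ?A \<union> insert z ` ?B"
  proof (intro equalityI subsetI)
    fix W assume W: "W \<in> ?X"
    show "W \<in> ?A \<union> insert z ` ?B"
    proof (cases "z \<in> W")
      case True
      then have W': "W = insert z (W - {z})" "W - {z} \<subseteq> pverts G"
        using W by auto
      then have "isomorphic (add_isolated (induced G (W - {z})) z) F"
        using W induced_add_isolated(2)[OF G(2) W'(2) G(1)] by simp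
      then show ?thesis
        using W' by blast
    next
      case False
      then have "W \<subseteq> pverts G"
        using W by auto
      then show ?thesis
        using W induced_add_isolated(1)[OF G(2) _ G(1)] by simp
    qed
  next
    fix W assume "W \<in> ?A \<union> insert z ` ?B"
    then show "W \<in> ?X"
      by (auto simp: induced_add_isolated[OF G(2) _ G(1)])
  qed
  moreover have "?A \<inter> insert z ` ?B = {}"
    using G(2) by auto
  moreover have "finite ?A" "finite ?B"
    using G by (auto intro: finite_subset[of _ "Pow (pverts G)"])
  moreover have "inj_on (insert z) ?B"
    using G(2) by (intro inj_onI) (metis (mono_tags, lifting) insert_ident mem_Collect_eq subset_iff)
  ultimately show ?thesis
    using G by (simp add: induced_count_eq card_Un_disjoint card_image)
qed

text \<open>A copy that used \<open>z\<close> would have an isolated vertex.\<close>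

lemma induced_count_add_isolated_no_isolated:
  assumes G: "pair_graph G" "z \<notin> pverts G" and F: "pair_graph F" "\<nexists>v. isolated F v"
  shows "induced_count (add_isolated G z) F = induced_count G F"
proof -
  have "\<not> isomorphic (add_isolated (induced G W) z) F" if "W \<subseteq> pverts G" for W
  proof
    assume i: "isomorphic (add_isolated (induced G W) z) F"
    have p: "pair_graph (add_isolated (induced G W) z)"
      using that G by simp
    have "isolated (add_isolated (induced G W) z) z"
      using that G by (intro isolated_add_isolated) auto
    then show False
      using ex_isolated_isomorphic[OF isomorphic_sym[OF i p] F(1) p] F(2) by blast
  qed
  then have empty: "{W. W \<subseteq> pverts G \<and> isomorphic (add_isolated (induced G W) z) F} = {}"
    by blast
  show ?thesis
    unfolding induced_count_add_isolated[OF G] empty by simp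
qed

text \<open>By cancellation, the copies that use \<open>z\<close> are copies of \<open>F\<close> in
  \<open>G\<close> together with \<open>z\<close>.\<close>

lemma induced_count_add_isolated_both:
  assumes G: "pair_graph G" "z \<notin> pverts G" and F: "pair_graph F" "w \<notin> pverts F"
  shows "induced_count (add_isolated G z) (add_isolated F w) =
    induced_count G (add_isolated F w) + induced_count G F"
proof -
  have "isomorphic (add_isolated (induced G W) z) (add_isolated F w) \<longleftrightarrow> isomorphic (induced G W) F"
    if "W \<subseteq> pverts G" for W
    using that G F by (intro isomorphic_add_isolated_iff) auto
  then have "{W. W \<subseteq> pverts G \<and> isomorphic (add_isolated (induced G W) z) (add_isolated F w)} =
      {W. W \<subseteq> pverts G \<and> isomorphic (induced G W) F}"
    by blast
  then show ?thesis
    using induced_count_add_isolated[OF G, of "add_isolated F w"] G by (simp add: induced_count_eq)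
qed

section \<open>From the matrix to the deck\<close>

text \<open>The bijection is \<open>\<rho>\<close> on \<open>A\<close> and the identity on
  \<open>C\<close>, so the block of \<open>C\<close> with itself agrees trivially and three blocks
  remain to be checked.\<close>

lemma unlabelled_matrix_eq_Un:
  assumes \<rho>: "bij_betw \<rho> A B" and disj: "A \<inter> C = {}" "B \<inter> C = {}"
    and AA: "\<And>s t. s \<in> A \<Longrightarrow> t \<in> A \<Longrightarrow> M s t = M (\<rho> s) (\<rho> t)"
    and AC: "\<And>s t. s \<in> A \<Longrightarrow> t \<in> C \<Longrightarrow> M s t = M (\<rho> s) t"
    and CA: "\<And>s t. s \<in> C \<Longrightarrow> t \<in> A \<Longrightarrow> M s t = M s (\<rho> t)"
  shows "unlabelled_matrix_eq (A \<union> C) M (B \<union> C) M"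
  unfolding unlabelled_matrix_eq_def
proof (intro exI conjI ballI)
  let ?\<sigma> = "\<lambda>s. if s \<in> A then \<rho> s else id s"
  show "bij_betw ?\<sigma> (A \<union> C) (B \<union> C)"
    by (intro bij_betw_disjoint_Un \<rho> bij_betw_id disj)
  show "M s t = M (?\<sigma> s) (?\<sigma> t)" if "s \<in> A \<union> C" "t \<in> A \<union> C" for s t
    using that AA AC CA by auto
qed

text \<open>Separates the only index of full size from the smaller ones, on which a bijection can be
  the identity.\<close>

lemma Lambda_eq_insert:
  assumes "pair_graph G" "nonempty_graph G"
  shows "Lambda G = {ty G} \<union> ty ` {F. nonempty_below G F}"
proof (intro equalityI subsetI)
  fix T assume "T \<in> Lambda G"
  then obtain F where F: "pair_graph F" "nonempty_graph F" "0 < induced_count G F" "T = ty F"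
    unfolding Lambda_iff[OF assms(1)] by (elim exE conjE)
  show "T \<in> {ty G} \<union> ty ` {F. nonempty_below G F}"
  proof (cases "card (pverts F) < card (pverts G)")
    case True
    then show ?thesis
      using F by (simp add: nonempty_below_def)
  next
    case False
    then have "isomorphic G F"
      using induced_count_pos_card[OF F(3) assms(1) F(1)] by simp
    then have "ty G = ty F"
      using assms F by (simp add: ty_eq_iff)
    then show ?thesis
      using F by simp
  qed
next
  fix T assume "T \<in> {ty G} \<union> ty ` {F. nonempty_below G F}"
  then show "T \<in> Lambda G"
    using assms by (auto simp: ty_in_Lambda_iff nonempty_below_def induced_count_self)
qed

text \<open>By Kelly's lemma \<open>G\<close> and \<open>H\<close> have the same smaller types with
  the same counts. Only \<open>ty G\<close> is relabelled, to \<open>ty H\<close>, and the smaller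
  graphs have 0 in either column.\<close>

lemma same_N_matrix_if_deck_eq:
  assumes GH: "pair_graph G" "pair_graph H" "nonempty_graph G" "nonempty_graph H"
    and deck: "vertex_deck G = vertex_deck H"
  shows "same_N_matrix G H"
proof -
  have card: "card (pverts G) = card (pverts H)"
    using GH deck by (metis size_vertex_deck)
  have eq: "induced_count G F = induced_count H F" if "pair_graph F" "card (pverts F) < card (pverts G)" for F
    using kelly GH deck that by blast
  have below: "nonempty_below G = nonempty_below H"
    using eq card by (auto simp: nonempty_below_def fun_eq_iff)
  let ?C = "ty ` {F. nonempty_below G F}"
  have notin: "ty K \<notin> ?C" if "pair_graph K" "card (pverts K) = card (pverts G)" for K
    using that isomorphic_card[OF _ that(1)] by (fastforce simp: nonempty_below_def ty_eq_iff)
  have zero: "induced_count F K = 0" if "nonempty_below G F" "pair_graph K" "card (pverts K) = card (pverts G)" for F K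
    using that induced_count_pos_card(1)[of F K] by (fastforce simp: nonempty_below_def)
  have "unlabelled_matrix_eq ({ty G} \<union> ?C) N_entry ({ty H} \<union> ?C) N_entry"
  proof (rule unlabelled_matrix_eq_Un[where \<rho> = "\<lambda>_. ty H"])
    show "bij_betw (\<lambda>_. ty H) {ty G} {ty H}"
      by (simp add: bij_betw_def)
    show "{ty G} \<inter> ?C = {}" "{ty H} \<inter> ?C = {}"
      using notin GH card by simp_all
    show "N_entry s t = N_entry (ty H) (ty H)" if "s \<in> {ty G}" "t \<in> {ty G}" for s t
      using that GH by (simp add: N_entry_ty induced_count_self)
    show "N_entry s t = N_entry (ty H) t" if st: "s \<in> {ty G}" "t \<in> ?C" for s t
    proof -
      obtain F where F: "t = ty F" "nonempty_below G F"
        using st by blast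
      then show ?thesis
        using st GH eq by (simp add: N_entry_ty nonempty_below_def)
    qed
    show "N_entry s t = N_entry s (ty H)" if st: "s \<in> ?C" "t \<in> {ty G}" for s t
    proof -
      obtain F where F: "s = ty F" "nonempty_below G F"
        using st by blast
      then have "pair_graph F"
        by (simp add: nonempty_below_def)
      then show ?thesis
        using st F GH card zero by (simp add: N_entry_ty)
    qed
  qed
  then show ?thesis
    unfolding same_N_matrix_def Lambda_eq_insert[OF GH(1,3)] Lambda_eq_insert[OF GH(2,4)] below .
qed

text \<open>Kelly's lemma covers the smaller graphs \<open>F\<close>, and those of the size of
  \<open>G\<close> count 0 in both. In the enlarged graphs, the copies of \<open>F\<close> through
  \<open>z\<close> are counted by removing an isolated vertex from \<open>F\<close>.\<close>

lemma induced_count_add_isolated_if_deck_eq: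
  assumes GH: "pair_graph G" "pair_graph H" and deck: "vertex_deck G = vertex_deck H"
    and z: "z \<notin> pverts G" "z \<notin> pverts H"
    and F: "pair_graph F" "card (pverts F) \<le> card (pverts G)" "\<not> isomorphic G F" "\<not> isomorphic H F"
  shows "induced_count G F = induced_count H F"
    and "induced_count (add_isolated G z) F = induced_count (add_isolated H z) F"
proof -
  have card: "card (pverts G) = card (pverts H)"
    using GH deck by (metis size_vertex_deck)
  show eq: "induced_count G F = induced_count H F"
  proof (cases "card (pverts F) < card (pverts G)")
    case True
    then show ?thesis
      using kelly GH deck F by blast
  next
    case False
    then show ?thesis
      using induced_count_eq_0[of G F] induced_count_eq_0[of H F] GH F card by simp
  qed
  show "induced_count (add_isolated G z) F = induced_count (add_isolated H z) F"
  proof (cases "\<exists>w. isolated F w")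
    case True
    then obtain w where w: "isolated F w" ..
    \<comment> \<open>Even if \<open>F\<close> is as large as \<open>G\<close>, the graph
      \<open>F'\<close> is smaller, which brings it within reach of Kelly's lemma.\<close>
    define F' where "F' = induced F (pverts F - {w})"
    have "w \<in> pverts F"
      using w by (simp add: isolated_def)
    then have F': "pair_graph F'" "w \<notin> pverts F'" "card (pverts F') < card (pverts G)"
      using F card_gt_0_iff[of "pverts F"] unfolding F'_def by auto
    have "F = add_isolated F' w"
      using isolated_eq_add_isolated[OF F(1) w] by (simp add: F'_def)
    moreover have "induced_count G F' = induced_count H F'"
      using kelly GH deck F' by blast
    ultimately show ?thesis
      using eq induced_count_add_isolated_both[OF _ _ F'(1,2)] GH z by simp
  next
    case False
    then show ?thesis
      using eq induced_count_add_isolated_no_isolated[OF _ _ F(1)] GH z by simp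
  qed
qed

text \<open>Each index set consists of the original type, the enlarged type and a common block. The
  bijection matches the first two in order and fixes the block.\<close>

lemma same_N_matrix_add_isolated:
  assumes GH: "pair_graph G" "pair_graph H" "nonempty_graph G" "nonempty_graph H"
    and deck: "vertex_deck G = vertex_deck H"
    and z: "z \<notin> pverts G" "z \<notin> pverts H"
    and no_isolated: "\<nexists>v. isolated G v" "\<nexists>v. isolated H v"
    and niso: "\<not> isomorphic G H"
  shows "same_N_matrix (add_isolated G z) (add_isolated H z)"
proof -
  let ?G = "add_isolated G z" and ?H = "add_isolated H z"
  have card: "card (pverts G) = card (pverts H)"
    using GH deck by (metis size_vertex_deck)
  have card': "card (pverts ?G) = Suc (card (pverts G))" "card (pverts ?H) = Suc (card (pverts G))"
    using GH z card by simp_all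
  have niso': "\<not> isomorphic H G"
    using niso GH isomorphic_sym by blast
  have pg: "pair_graph ?G" "pair_graph ?H" "nonempty_graph ?G" "nonempty_graph ?H"
    using GH by simp_all
  \<comment> \<open>The common block: its types avoid both \<open>G\<close> and \<open>H\<close>, so
    that their counts agree on the two sides.\<close>
  define P where "P F \<longleftrightarrow> nonempty_below ?G F \<and> \<not> isomorphic G F \<and> \<not> isomorphic H F" for F
  have P: "pair_graph F" "card (pverts F) \<le> card (pverts G)" "\<not> isomorphic G F" "\<not> isomorphic H F"
    if "P F" for F
    using that card' unfolding P_def nonempty_below_def by simp_all
  note counts = induced_count_add_isolated_if_deck_eq[OF GH(1,2) deck z]
  have P_H: "P F \<longleftrightarrow> nonempty_below ?H F \<and> \<not> isomorphic G F \<and> \<not> isomorphic H F" for F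
    using counts(2)[of F] card' unfolding P_def nonempty_below_def by auto
  \<comment> \<open>As \<open>G\<close> and \<open>H\<close> have no isolated vertices, their copies
    in the enlarged graphs avoid \<open>z\<close>; each original graph thus occurs once in its own
    enlargement and not in the other.\<close>
  have self: "induced_count ?G G = 1" "induced_count ?H H = 1" "induced_count ?G H = 0" "induced_count ?H G = 0"
    using induced_count_add_isolated_no_isolated GH z no_isolated induced_count_self
      induced_count_eq_0[of G H] induced_count_eq_0[of H G] niso niso' card by simp_all
  \<comment> \<open>Stated for a generic \<open>K\<close> to serve both \<open>G\<close> and
    \<open>H\<close>. By \<open>other\<close>, of these two types only that of \<open>K\<close>
    occurs.\<close>
  have Lambda: "Lambda (add_isolated K z) = {ty K, ty (add_isolated K z)} \<union> ty ` {F. P F}"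
    if K: "pair_graph K" "nonempty_graph K" "z \<notin> pverts K"
      and self: "induced_count (add_isolated K z) K = 1"
      and other: "\<And>F. pair_graph F \<Longrightarrow> 0 < induced_count (add_isolated K z) F \<Longrightarrow>
        isomorphic G F \<or> isomorphic H F \<Longrightarrow> isomorphic K F"
      and PK: "\<And>F. P F \<longleftrightarrow> nonempty_below (add_isolated K z) F \<and> \<not> isomorphic G F \<and> \<not> isomorphic H F"
    for K
  proof -
    have below_K: "nonempty_below (add_isolated K z) K"
      using K self by (simp add: nonempty_below_def)
    have "ty ` {F. nonempty_below (add_isolated K z) F} = insert (ty K) (ty ` {F. P F})"
    proof (intro equalityI subsetI)
      fix T assume "T \<in> ty ` {F. nonempty_below (add_isolated K z) F}"
      then obtain F where F: "nonempty_below (add_isolated K z) F" "T = ty F"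
        by blast
      then have pF: "pair_graph F" "0 < induced_count (add_isolated K z) F"
        by (simp_all add: nonempty_below_def)
      show "T \<in> insert (ty K) (ty ` {F. P F})"
      proof (cases "isomorphic G F \<or> isomorphic H F")
        case True
        then have "ty K = ty F"
          using other pF K by (simp add: ty_eq_iff)
        then show ?thesis
          using F by simp
      next
        case False
        then show ?thesis
          using F PK[of F] by simp
      qed
    next
      fix T assume "T \<in> insert (ty K) (ty ` {F. P F})"
      then show "T \<in> ty ` {F. nonempty_below (add_isolated K z) F}"
        using below_K PK by blast
    qed
    then show ?thesis
      using Lambda_eq_insert[of "add_isolated K z"] K by simp
  qed
  have other: "\<not> isomorphic B F"
    if "pair_graph A" "pair_graph B" "pair_graph F" "induced_count A B = 0" "0 < induced_count A F" for A B F
    using that induced_count_cong[of A A B F] by fastforce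
  have LG: "Lambda ?G = {ty G, ty ?G} \<union> ty ` {F. P F}"
    using Lambda[OF GH(1,3) z(1) self(1) _ P_def] other[OF pg(1) GH(2) _ self(3)] by blast
  have LH: "Lambda ?H = {ty H, ty ?H} \<union> ty ` {F. P F}"
    using Lambda[OF GH(2,4) z(2) self(2) _ P_H] other[OF pg(2) GH(1) _ self(4)] by blast
  have ne: "ty G \<noteq> ty ?G" "ty H \<noteq> ty ?H"
    using GH pg card card' isomorphic_card[of G ?G] isomorphic_card[of H ?H] by (auto simp: ty_eq_iff)
  \<comment> \<open>Only the values at \<open>ty G\<close> and \<open>ty ?G\<close> matter; the
    second case stands for \<open>ty ?G\<close>.\<close>
  define \<rho> where "\<rho> s = (if s = ty G then ty H else ty ?H)" for s
  have \<rho>: "\<rho> (ty G) = ty H" "\<rho> (ty ?G) = ty ?H"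
    using ne by (simp_all add: \<rho>_def)
  have big: "induced_count F ?G = 0" "induced_count F ?H = 0"
    if F: "pair_graph F" "card (pverts F) \<le> card (pverts G)" for F
  proof -
    have "\<not> 0 < induced_count F ?G"
      using induced_count_pos_card(1)[OF _ F(1) pg(1)] F card' by linarith
    moreover have "\<not> 0 < induced_count F ?H"
      using induced_count_pos_card(1)[OF _ F(1) pg(2)] F card' by linarith
    ultimately show "induced_count F ?G = 0" "induced_count F ?H = 0"
      by simp_all
  qed
  have "unlabelled_matrix_eq ({ty G, ty ?G} \<union> ty ` {F. P F}) N_entry ({ty H, ty ?H} \<union> ty ` {F. P F}) N_entry"
  proof (rule unlabelled_matrix_eq_Un[where \<rho> = \<rho>])
    show "bij_betw \<rho> {ty G, ty ?G} {ty H, ty ?H}"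
      using ne \<rho> by (simp add: bij_betw_def)
    have notin: "ty K \<notin> ty ` {F. P F}"
      if K: "pair_graph K" and nP: "\<And>F. P F \<Longrightarrow> \<not> isomorphic K F" for K
    proof
      assume "ty K \<in> ty ` {F. P F}"
      then obtain F where F: "P F" "ty K = ty F"
        by blast
      then have "isomorphic K F"
        using P(1)[OF F(1)] K by (simp add: ty_eq_iff)
      then show False
        using nP[OF F(1)] by simp
    qed
    have "\<not> isomorphic ?G F" "\<not> isomorphic ?H F" if "P F" for F
      using P[OF that] isomorphic_card[of ?G F] isomorphic_card[of ?H F] pg card' by auto
    then show "{ty G, ty ?G} \<inter> ty ` {F. P F} = {}" "{ty H, ty ?H} \<inter> ty ` {F. P F} = {}"
      using notin GH pg P(3,4) by simp_all
    show "N_entry s t = N_entry (\<rho> s) (\<rho> t)" if "s \<in> {ty G, ty ?G}" "t \<in> {ty G, ty ?G}" for s t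
      using that GH pg self big card by (auto simp: \<rho> N_entry_ty induced_count_self)
    show "N_entry s t = N_entry (\<rho> s) t" if st: "s \<in> {ty G, ty ?G}" "t \<in> ty ` {F. P F}" for s t
    proof -
      obtain F where F: "t = ty F" "P F"
        using st by blast
      show ?thesis
        using st(1) counts[OF P[OF F(2)]] P(1)[OF F(2)] GH pg by (auto simp: F(1) \<rho> N_entry_ty)
    qed
    show "N_entry s t = N_entry s (\<rho> t)" if st: "s \<in> ty ` {F. P F}" "t \<in> {ty G, ty ?G}" for s t
    proof -
      obtain F where F: "s = ty F" "P F"
        using st by blast
      note PF = P[OF F(2)]
      \<comment> \<open>\<open>F\<close> may be as large as \<open>G\<close>, so size alone does not
        make these columns vanish.\<close>
      have "\<not> isomorphic F G" "\<not> isomorphic F H"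
        using PF isomorphic_sym by blast+
      then have "induced_count F G = 0" "induced_count F H = 0"
        using induced_count_eq_0 PF GH card by simp_all
      then show ?thesis
        using st(2) PF(1) big[OF PF(1,2)] GH pg by (auto simp: F(1) \<rho> N_entry_ty)
    qed
  qed
  then show ?thesis
    unfolding same_N_matrix_def LG LH .
qed

text \<open>Edgeless graphs are settled by their number of vertices. All others reduce to a matrix
  comparison with a graph having an isolated vertex, which is disconnected.\<close>

lemma N_reconstructible_imp_ulam:
  assumes rec: "\<And>G. pair_graph G \<Longrightarrow> 3 \<le> card (pverts G) \<Longrightarrow> nonempty_graph G \<Longrightarrow>
      \<not> Digraph_Component.connected (with_proj G) \<Longrightarrow> N_reconstructible G"
    and GH: "pair_graph G" "pair_graph H" "3 \<le> card (pverts G)" "vertex_deck G = vertex_deck H"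
  shows "isomorphic G H"
proof -
  have card: "card (pverts G) = card (pverts H)"
    using GH by (metis size_vertex_deck)
  show ?thesis
  proof (cases "nonempty_graph G")
    case False
    then have "\<not> nonempty_graph H"
      using nonempty_of_deck_eq[of H G] GH card by auto
    then show ?thesis
      using False empty_isomorphic GH card by blast
  next
    case True
    then have ne: "nonempty_graph G" "nonempty_graph H"
      using nonempty_of_deck_eq[of G H] GH by simp_all
    \<comment> \<open>Reconstructibility is needed only for \<open>K\<close>, so it does not matter
      which of the two graphs has the isolated vertex.\<close>
    have isolated_case: "isomorphic L K"
      if K: "pair_graph K" "nonempty_graph K" "3 \<le> card (pverts K)" "isolated K v"
        and L: "pair_graph L" "nonempty_graph L" "same_N_matrix L K" for K L v
    proof -
      have "N_reconstructible K"
        using rec K isolated_not_connected[OF K(4)] by simp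
      then show ?thesis
        using L by (simp add: N_reconstructible_def)
    qed
    show ?thesis
    proof (cases "(\<exists>v. isolated G v) \<or> (\<exists>v. isolated H v)")
      case True
      then show ?thesis
      proof
        assume "\<exists>v. isolated G v"
        then obtain v where "isolated G v" ..
        then have "isomorphic H G"
          using isolated_case[of G v H] same_N_matrix_if_deck_eq[of H G] GH ne by simp
        then show ?thesis
          using isomorphic_sym GH by blast
      next
        assume "\<exists>v. isolated H v"
        then obtain v where "isolated H v" ..
        then show ?thesis
          using isolated_case[of H v G] same_N_matrix_if_deck_eq[of G H] GH ne card by simp
      qed
    next
      case False
      have "finite (pverts G \<union> pverts H)"
        using GH by simp
      then obtain z where z: "z \<notin> pverts G" "z \<notin> pverts H"
        using ex_new_if_finite[OF infinite_UNIV_nat] by blast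
      show ?thesis
      proof (rule ccontr)
        \<comment> \<open>Non-isomorphism keeps the types of \<open>G\<close> and \<open>H\<close>
          apart, as the comparison of the enlarged matrices requires.\<close>
        assume niso: "\<not> isomorphic G H"
        have "same_N_matrix (add_isolated G z) (add_isolated H z)"
          using same_N_matrix_add_isolated[OF GH(1,2) ne GH(4) z _ _ niso] False by blast
        moreover have "3 \<le> card (pverts (add_isolated H z))"
          using GH z card by simp
        ultimately have "isomorphic (add_isolated G z) (add_isolated H z)"
          using isolated_case[of "add_isolated H z" z "add_isolated G z"] isolated_add_isolated[OF GH(2) z(2)]
            GH ne by simp
        then show False
          using isomorphic_add_isolated_iff GH z niso by blast
      qed
    qed
  qed
qed

theorem theorem2p12:
  shows "(\<forall>G H :: ngraph. pair_graph G \<and> pair_graph H \<and>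
              card (pverts G) > 2 \<and> card (pverts H) > 2 \<and> vertex_deck G = vertex_deck H
            \<longrightarrow> isomorphic G H)
     \<longleftrightarrow>
         (\<forall>G :: ngraph. pair_graph G \<and> card (pverts G) \<ge> 3 \<and> nonempty_graph G \<and>
              \<not> Digraph_Component.connected (with_proj G)
            \<longrightarrow> N_reconstructible G)"
    (is "?ulam \<longleftrightarrow> ?rec")
proof
  assume ?ulam
  then have ulam_conjecture
    unfolding ulam_conjecture_def .
  then show ?rec
    unfolding N_reconstructible_def using ulam_imp_N_matrix_determines by blast
next
  assume ?rec
  then have rec: "N_reconstructible G" if "pair_graph G" "3 \<le> card (pverts G)" "nonempty_graph G"
    "\<not> Digraph_Component.connected (with_proj G)" for G
    using that by blast
  show ?ulam
  proof (intro allI impI, elim conjE)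
    fix G H :: ngraph
    assume "pair_graph G" "pair_graph H" "2 < card (pverts G)" "vertex_deck G = vertex_deck H"
    then show "isomorphic G H"
      using N_reconstructible_imp_ulam[OF rec] by simp
  qed
qed

end
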